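(* Given a Fixed-Permutation State-Space Model (FPSSM) of state-size $k$ there exists a D&C SPN of size $O(nk^2)$ which computes the same function.
   Context: FPSSM: let $x=(x_1,\dots,x_n)$ with $x_i\in R_i\subseteq\mathbb{R}$, and $[k]=\{1,\dots,k\}$. An FPSSM is given by a fixed permutation $\pi$ of $[n]$, a state-size constant $k$, an initial state $c\in[k]$, an arbitrary decoding function $h:[k]\to\mathbb{R}_{\ge0}$, and for each $i\in[n]$ an arbitrary function $g_i$ mapping values of $x_i$ and elements of $[k]$ to elements of $[k]$. Its output is $h\big(g_{\pi(n)}(x_{\pi(n)},g_{\pi(n-1)}(x_{\pi(n-1)},\cdots g_{\pi(1)}(x_{\pi(1)},c)\cdots))\big)$. Arithmetic circuits: an arithmetic circuit $\Phi$ over a tuple of variables $y$ is a finite directed acyclic graph with a unique node of out-degree $0$ (the root). Each node of in-degree $0$ is labeled by a variable of $y$ or a real constant; every other node is labeled $\times$ (product node) or $+$ (sum node), and edges into sum nodes carry real weights. The children $C(u)$ of $u$ are the nodes with an edge into $u$. Labeled leaves compute their labels, a product node computes $q_u=\prod_{v\in C(u)}q_v$, a sum node computes $q_u=\sum_{v\in C(u)}w_{v,u}q_v$; $q_\Phi$ is the polynomial computed by the root. $\Phi$ is monotone if all weights and constants are non-negative. The size is the number of nodes. SPNs: let $M_i$ be a measure on $R_i$ and let $f$ be a tuple of non-negative univariate functions $f_{i,j}(x_i)$, each with finite $M_i$-integral over $R_i$. A Sum Product Network (SPN) is a monotone arithmetic circuit over $f$ (the $f_{i,j}$ regarded as formal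 variables; the choice of $f$ is part of the SPN); it computes the function $x\mapsto q_\Phi(f(x))$. The dependency-scope of a node $u$ is the set of those $x_i$ such that some $f_{i,j}$ labels a node in the sub-circuit rooted at $u$. An SPN is decomposable if for every product node the dependency-scopes of its children are pairwise disjoint, complete if for every sum node the dependency-scopes of its children are all the same, and a D&C SPN if it is both.
   Formalization: The SPN is obtained for some measures M_i for every FPSSM, and, with the same circuit and f, for all finite measures M_i on R_i making every g_i(·,a) measurable; for arbitrary given M_i (e.g. Lebesgue on the reals) the claim fails. n ≥ 1 is assumed. *)

theory Defs
  imports "HOL-Analysis.Analysis" "HOL-Combinatorics.Permutations"
begin

section \<open>Fixed-permutation state-space models\<close>

text \<open>
  The index set $[n]$ is \<open>{1..n}\<close> and the state set $[k]$ is \<open>{1..k}\<close>. An input is a function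
  \<open>x\<close> with \<open>x i \<in> R i\<close> for \<open>i \<in> {1..n}\<close>; the other values of \<open>x\<close> are irrelevant. There is at
  least one variable (for \<open>n = 0\<close> no circuit has size $O(n k^2) = 0$). \<open>k \<ge> 1\<close> follows from
  \<open>c \<in> {1..k}\<close>.
\<close>

definition fpssm ::
  "nat \<Rightarrow> (nat \<Rightarrow> real set) \<Rightarrow> nat \<Rightarrow> (nat \<Rightarrow> nat) \<Rightarrow> nat \<Rightarrow> (nat \<Rightarrow> real) \<Rightarrow>
    (nat \<Rightarrow> real \<Rightarrow> nat \<Rightarrow> nat) \<Rightarrow> bool" where
  "fpssm n R k \<pi> c h g \<longleftrightarrow>
     n \<ge> 1 \<and> \<pi> permutes {1..n} \<and> c \<in> {1..k} \<and>
     (\<forall>a\<in>{1..k}. h a \<ge> 0) \<and>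
     (\<forall>i\<in>{1..n}. \<forall>x\<in>R i. \<forall>a\<in>{1..k}. g i x a \<in> {1..k})"

primrec fpssm_state ::
  "(nat \<Rightarrow> nat) \<Rightarrow> nat \<Rightarrow> (nat \<Rightarrow> real \<Rightarrow> nat \<Rightarrow> nat) \<Rightarrow> (nat \<Rightarrow> real) \<Rightarrow> nat \<Rightarrow> nat" where
  "fpssm_state \<pi> c g x 0 = c"
| "fpssm_state \<pi> c g x (Suc t) =
     g (\<pi> (Suc t)) (x (\<pi> (Suc t))) (fpssm_state \<pi> c g x t)"

definition fpssm_output ::
  "nat \<Rightarrow> (nat \<Rightarrow> nat) \<Rightarrow> nat \<Rightarrow> (nat \<Rightarrow> real) \<Rightarrow> (nat \<Rightarrow> real \<Rightarrow> nat \<Rightarrow> nat) \<Rightarrow>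
    (nat \<Rightarrow> real) \<Rightarrow> real" where
  "fpssm_output n \<pi> c h g x = h (fpssm_state \<pi> c g x n)"


section \<open>Arithmetic circuits\<close>

datatype 'y node_label = Variable 'y | Constant real | Product | Sum

text \<open>
  Edges point from a child to its parent; \<open>weight \<Phi> v u\<close> is only meaningful when \<open>(v, u)\<close> is an
  edge into a sum node \<open>u\<close>.
\<close>

record ('v, 'y) circuit =
  nodes :: "'v set"
  edges :: "('v \<times> 'v) set"
  label :: "'v \<Rightarrow> 'y node_label"
  weight :: "'v \<Rightarrow> 'v \<Rightarrow> real"

definition children :: "('v, 'y) circuit \<Rightarrow> 'v \<Rightarrow> 'v set" where
  "children \<Phi> u = {v. (v, u) \<in> edges \<Phi>}"

definition is_root :: "('v, 'y) circuit \<Rightarrow> 'v \<Rightarrow> bool" where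
  "is_root \<Phi> u \<longleftrightarrow> u \<in> nodes \<Phi> \<and> (\<forall>w. (u, w) \<notin> edges \<Phi>)"

definition root :: "('v, 'y) circuit \<Rightarrow> 'v" where
  "root \<Phi> = (THE u. is_root \<Phi> u)"

definition arithmetic_circuit :: "'y set \<Rightarrow> ('v, 'y) circuit \<Rightarrow> bool" where
  "arithmetic_circuit Y \<Phi> \<longleftrightarrow>
     finite (nodes \<Phi>) \<and> edges \<Phi> \<subseteq> nodes \<Phi> \<times> nodes \<Phi> \<and> acyclic (edges \<Phi>) \<and>
     (\<exists>!u. is_root \<Phi> u) \<and>
     (\<forall>u\<in>nodes \<Phi>.
        if children \<Phi> u = {}
        then label \<Phi> u \<in> Variable ` Y \<union> range Constant
        else label \<Phi> u \<in> {Product, Sum})"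

text \<open>
  The value of (the polynomial computed by) each node when the variables are given the values
  \<open>\<rho>\<close>, by recursion along the child relation, which is well-founded in an arithmetic circuit.
\<close>

definition node_value :: "('v, 'y) circuit \<Rightarrow> ('y \<Rightarrow> real) \<Rightarrow> 'v \<Rightarrow> real" where
  "node_value \<Phi> \<rho> =
     wfrec (edges \<Phi>) (\<lambda>q u.
       case label \<Phi> u of
         Variable y \<Rightarrow> \<rho> y
       | Constant r \<Rightarrow> r
       | Product \<Rightarrow> (\<Prod>v\<in>children \<Phi> u. q v)
       | Sum \<Rightarrow> (\<Sum>v\<in>children \<Phi> u. weight \<Phi> v u * q v))"

lemma node_value_unfold:
  assumes "arithmetic_circuit Y \<Phi>"
  shows "node_value \<Phi> \<rho> u =
    (case label \<Phi> u of
       Variable y \<Rightarrow> \<rho> y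
     | Constant r \<Rightarrow> r
     | Product \<Rightarrow> (\<Prod>v\<in>children \<Phi> u. node_value \<Phi> \<rho> v)
     | Sum \<Rightarrow> (\<Sum>v\<in>children \<Phi> u. weight \<Phi> v u * node_value \<Phi> \<rho> v))"
proof -
  have "finite (edges \<Phi>)" "acyclic (edges \<Phi>)"
    using assms finite_subset[of "edges \<Phi>" "nodes \<Phi> \<times> nodes \<Phi>"]
    by (auto simp: arithmetic_circuit_def)
  then have "wf (edges \<Phi>)" by (rule finite_acyclic_wf)
  then show ?thesis
    by (subst def_wfrec[OF node_value_def[THEN eq_reflection]])
       (auto simp: cut_def children_def split: node_label.split
             intro!: prod.cong sum.cong)
qed

definition circuit_value :: "('v, 'y) circuit \<Rightarrow> ('y \<Rightarrow> real) \<Rightarrow> real" where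
  "circuit_value \<Phi> \<rho> = node_value \<Phi> \<rho> (root \<Phi>)"

definition monotone_circuit :: "('v, 'y) circuit \<Rightarrow> bool" where
  "monotone_circuit \<Phi> \<longleftrightarrow>
     (\<forall>u\<in>nodes \<Phi>. \<forall>r. label \<Phi> u = Constant r \<longrightarrow> r \<ge> 0) \<and>
     (\<forall>u\<in>nodes \<Phi>. label \<Phi> u = Sum \<longrightarrow> (\<forall>v\<in>children \<Phi> u. weight \<Phi> v u \<ge> 0))"

definition circuit_size :: "('v, 'y) circuit \<Rightarrow> nat" where
  "circuit_size \<Phi> = card (nodes \<Phi>)"


section \<open>Sum product networks\<close>

text \<open>
  The formal variable $f_{i,j}$ is the pair \<open>(i, j)\<close>. The tuple has \<open>m i\<close> functions of \<open>x i\<close>,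
  so that \<open>j\<close> ranges over \<open>{1..m i}\<close>.
\<close>

definition spn ::
  "nat \<Rightarrow> (nat \<Rightarrow> real set) \<Rightarrow> (nat \<Rightarrow> real measure) \<Rightarrow> (nat \<Rightarrow> nat) \<Rightarrow>
    (nat \<Rightarrow> nat \<Rightarrow> real \<Rightarrow> real) \<Rightarrow> ('v, nat \<times> nat) circuit \<Rightarrow> bool" where
  "spn n R M m f \<Phi> \<longleftrightarrow>
     (\<forall>i\<in>{1..n}. space (M i) = R i) \<and>
     (\<forall>i\<in>{1..n}. \<forall>j\<in>{1..m i}. (\<forall>t\<in>R i. f i j t \<ge> 0) \<and> integrable (M i) (f i j)) \<and>
     arithmetic_circuit (SIGMA i:{1..n}. {1..m i}) \<Phi> \<and> monotone_circuit \<Phi>"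

definition spn_output ::
  "(nat \<Rightarrow> nat \<Rightarrow> real \<Rightarrow> real) \<Rightarrow> ('v, nat \<times> nat) circuit \<Rightarrow> (nat \<Rightarrow> real) \<Rightarrow> real" where
  "spn_output f \<Phi> x = circuit_value \<Phi> (\<lambda>(i, j). f i j (x i))"

definition dependency_scope :: "('v, nat \<times> nat) circuit \<Rightarrow> 'v \<Rightarrow> nat set" where
  "dependency_scope \<Phi> u = {i. \<exists>v j. (v, u) \<in> (edges \<Phi>)\<^sup>* \<and> label \<Phi> v = Variable (i, j)}"

definition decomposable :: "('v, nat \<times> nat) circuit \<Rightarrow> bool" where
  "decomposable \<Phi> \<longleftrightarrow>
     (\<forall>u\<in>nodes \<Phi>. label \<Phi> u = Product \<longrightarrow>
        (\<forall>v\<in>children \<Phi> u. \<forall>w\<in>children \<Phi> u. v \<noteq> w \<longrightarrow>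
           dependency_scope \<Phi> v \<inter> dependency_scope \<Phi> w = {}))"

definition complete_circuit :: "('v, nat \<times> nat) circuit \<Rightarrow> bool" where
  "complete_circuit \<Phi> \<longleftrightarrow>
     (\<forall>u\<in>nodes \<Phi>. label \<Phi> u = Sum \<longrightarrow>
        (\<forall>v\<in>children \<Phi> u. \<forall>w\<in>children \<Phi> u.
           dependency_scope \<Phi> v = dependency_scope \<Phi> w))"

definition dc_spn ::
  "nat \<Rightarrow> (nat \<Rightarrow> real set) \<Rightarrow> (nat \<Rightarrow> real measure) \<Rightarrow> (nat \<Rightarrow> nat) \<Rightarrow>
    (nat \<Rightarrow> nat \<Rightarrow> real \<Rightarrow> real) \<Rightarrow> ('v, nat \<times> nat) circuit \<Rightarrow> bool" where
  "dc_spn n R M m f \<Phi> \<longleftrightarrow> spn n R M m f \<Phi> \<and> decomposable \<Phi> \<and> complete_circuit \<Phi>"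

text \<open>
  A state-space model involves no measures, and its functions \<open>g i\<close> are arbitrary. For measures
  given in advance, representability by an SPN needs a condition: with \<open>n = 1\<close>, a D&C SPN computes
  a constant or a non-negative combination of integrable functions, but the indicator of the
  positive reals, which is the output of a state-space model with two states, is neither for
  Lebesgue measure on the real line. The condition below says exactly that the indicators of all
  sets \<open>{t \<in> R i. g i t a = b}\<close> are integrable. It holds for every \<open>g\<close> if the \<open>M i\<close> are finite
  measures for which all subsets of \<open>R i\<close> are measurable.
\<close>

definition compatible_measures ::
  "nat \<Rightarrow> (nat \<Rightarrow> real set) \<Rightarrow> nat \<Rightarrow> (nat \<Rightarrow> real \<Rightarrow> nat \<Rightarrow> nat) \<Rightarrow> (nat \<Rightarrow> real measure) \<Rightarrow> bool" where
  "compatible_measures n R k g M \<longleftrightarrow>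
     (\<forall>i\<in>{1..n}. space (M i) = R i \<and> finite_measure (M i) \<and>
        (\<forall>a\<in>{1..k}. (\<lambda>t. g i t a) \<in> M i \<rightarrow>\<^sub>M count_space {1..k}))"

end

theory Submission
  imports Defs
begin

text \<open>
  The circuit runs the state machine forwards on indicators. For every time \<open>t\<close> and state \<open>b\<close> there
  is a node computing the indicator of the event that the state at time \<open>t\<close> is \<open>b\<close>. It is obtained
  from the indicators at time \<open>t - 1\<close> by summing over the previous state \<open>a\<close> the product with the
  indicator of $g_{\pi(t)}(x_{\pi(t)}, a) = b$, which is a function of a single variable; the output
  weights the final indicators with \<open>h\<close>. A node at time \<open>t\<close> depends on exactly
  $x_{\pi(1)},\dots,x_{\pi(t)}$, hence the circuit is complete and decomposable.
\<close>

section \<open>Renaming the nodes of a circuit\<close>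

text \<open>The network is built on a custom datatype of nodes, while the final statement asks for
  nodes in \<open>nat\<close>; this transport bridges the two. Since labels and weights are read
  through \<open>inv e\<close>, it is faithful only for injective \<open>e\<close>.\<close>

definition map_nodes :: "('v \<Rightarrow> 'w) \<Rightarrow> ('v, 'y) circuit \<Rightarrow> ('w, 'y) circuit" where
  "map_nodes e \<Phi> =
     \<lparr>nodes = e ` nodes \<Phi>, edges = map_prod e e ` edges \<Phi>,
      label = (\<lambda>u. label \<Phi> (inv e u)), weight = (\<lambda>v u. weight \<Phi> (inv e v) (inv e u))\<rparr>"

lemma map_nodes_simps [simp]:
  "nodes (map_nodes e \<Phi>) = e ` nodes \<Phi>"
  "edges (map_nodes e \<Phi>) = map_prod e e ` edges \<Phi>"
  "inj e \<Longrightarrow> label (map_nodes e \<Phi>) (e u) = label \<Phi> u"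
  "inj e \<Longrightarrow> weight (map_nodes e \<Phi>) (e v) (e u) = weight \<Phi> v u"
  by (simp_all add: map_nodes_def)

lemma children_map_nodes [simp]:
  "inj e \<Longrightarrow> children (map_nodes e \<Phi>) (e u) = e ` children \<Phi> u"
  by (force simp: children_def inj_eq)

lemma is_root_map_nodes:
  "inj e \<Longrightarrow> is_root (map_nodes e \<Phi>) u \<longleftrightarrow> (\<exists>v. u = e v \<and> is_root \<Phi> v)"
  by (auto simp: is_root_def inj_eq)

text \<open>Injectivity gives the shared endpoint of two consecutive image edges a single preimage,
  so a path in the image lifts to a path.\<close>

lemma trancl_map_prod_image:
  assumes "inj e" "(x, y) \<in> (map_prod e e ` r)\<^sup>+"
  shows "\<exists>a b. x = e a \<and> y = e b \<and> (a, b) \<in> r\<^sup>+"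
  using assms(2)
proof (induction rule: trancl_induct)
  case (step y z)
  then show ?case using assms(1) by (auto simp: inj_eq intro: trancl_into_trancl)
qed auto

lemma rtrancl_map_prod_image:
  assumes "inj e"
  shows "(x, e b) \<in> (map_prod e e ` r)\<^sup>* \<longleftrightarrow> (\<exists>a. x = e a \<and> (a, b) \<in> r\<^sup>*)"
proof
  assume "(x, e b) \<in> (map_prod e e ` r)\<^sup>*"
  then show "\<exists>a. x = e a \<and> (a, b) \<in> r\<^sup>*"
    using trancl_map_prod_image[OF assms, of x "e b" r] assms
    by (auto simp: rtrancl_eq_or_trancl inj_eq)
next
  have "(e a, e b) \<in> (map_prod e e ` r)\<^sup>*" if "(a, b) \<in> r\<^sup>*" for a
    using that by induction (auto intro: rtrancl_into_rtrancl)
  then show "\<exists>a. x = e a \<and> (a, b) \<in> r\<^sup>* \<Longrightarrow> (x, e b) \<in> (map_prod e e ` r)\<^sup>*"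
    by auto
qed

lemma acyclic_map_prod_image: "inj e \<Longrightarrow> acyclic r \<Longrightarrow> acyclic (map_prod e e ` r)"
  unfolding acyclic_def by (metis injD trancl_map_prod_image)

lemma arithmetic_circuit_map_nodes:
  assumes "inj e" "arithmetic_circuit Y \<Phi>"
  shows "arithmetic_circuit Y (map_nodes e \<Phi>)"
proof -
  have "\<exists>!u. is_root (map_nodes e \<Phi>) u"
    using assms by (auto simp: is_root_map_nodes arithmetic_circuit_def)
  moreover have "map_prod e e ` edges \<Phi> \<subseteq> e ` nodes \<Phi> \<times> e ` nodes \<Phi>"
    using assms(2) by (auto simp: arithmetic_circuit_def)
  ultimately show ?thesis
    using assms
    by (simp add: arithmetic_circuit_def acyclic_map_prod_image
        cong: if_cong split del: if_split)
qed

lemma monotone_circuit_map_nodes: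
  "inj e \<Longrightarrow> monotone_circuit \<Phi> \<Longrightarrow> monotone_circuit (map_nodes e \<Phi>)"
  by (simp add: monotone_circuit_def)

lemma dependency_scope_map_nodes [simp]:
  "inj e \<Longrightarrow> dependency_scope (map_nodes e \<Phi>) (e u) = dependency_scope \<Phi> u"
  by (force simp: dependency_scope_def rtrancl_map_prod_image)

lemma decomposable_map_nodes [simp]:
  "inj e \<Longrightarrow> decomposable (map_nodes e \<Phi>) \<longleftrightarrow> decomposable \<Phi>"
  by (simp add: decomposable_def inj_eq)

lemma complete_circuit_map_nodes [simp]:
  "inj e \<Longrightarrow> complete_circuit (map_nodes e \<Phi>) \<longleftrightarrow> complete_circuit \<Phi>"
  by (simp add: complete_circuit_def)

lemma dc_spn_map_nodes:
  assumes "inj e" "dc_spn n R M m f \<Phi>"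
  shows "dc_spn n R M m f (map_nodes e \<Phi>)"
  using assms
  by (simp add: dc_spn_def spn_def arithmetic_circuit_map_nodes monotone_circuit_map_nodes)

lemma circuit_size_map_nodes: "inj e \<Longrightarrow> circuit_size (map_nodes e \<Phi>) = circuit_size \<Phi>"
  by (simp add: circuit_size_def card_image inj_on_subset)

lemma wf_edges:
  assumes "arithmetic_circuit Y \<Phi>"
  shows "wf (edges \<Phi>)"
  using assms finite_subset[of "edges \<Phi>" "nodes \<Phi> \<times> nodes \<Phi>"]
  by (auto simp: arithmetic_circuit_def intro: finite_acyclic_wf)

text \<open>Well-founded induction along the edges: both sides unfold to the same operation, and
  injectivity reindexes the sum or product over the children.\<close>

lemma node_value_map_nodes:
  assumes "inj e" "arithmetic_circuit Y \<Phi>"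
  shows "node_value (map_nodes e \<Phi>) \<rho> (e u) = node_value \<Phi> \<rho> u"
  using wf_edges[OF assms(2)]
proof (induction u rule: wf_induct_rule)
  case (less u)
  have inj: "inj_on e A" for A
    using assms(1) by (rule inj_on_subset) simp
  have IH: "node_value (map_nodes e \<Phi>) \<rho> (e v) = node_value \<Phi> \<rho> v" if "v \<in> children \<Phi> u" for v
    using less that by (simp add: children_def)
  show ?case
    unfolding node_value_unfold[OF assms(2), of \<rho> u]
      node_value_unfold[OF arithmetic_circuit_map_nodes[OF assms], of \<rho> "e u"]
    using assms(1)
    by (auto simp: IH prod.reindex[OF inj] sum.reindex[OF inj]
        split: node_label.split intro!: prod.cong sum.cong)
qed

lemma root_eqI:
  assumes "arithmetic_circuit Y \<Phi>" "is_root \<Phi> u"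
  shows "root \<Phi> = u"
  using assms by (auto simp: root_def arithmetic_circuit_def intro: the1_equality)

lemma spn_output_map_nodes:
  assumes "inj e" "arithmetic_circuit Y \<Phi>"
  shows "spn_output f (map_nodes e \<Phi>) x = spn_output f \<Phi> x"
proof -
  obtain u where u: "is_root \<Phi> u"
    using assms(2) by (auto simp: arithmetic_circuit_def)
  have "root (map_nodes e \<Phi>) = e u"
    using root_eqI[OF arithmetic_circuit_map_nodes[OF assms]] u assms(1)
    by (auto simp: is_root_map_nodes)
  with root_eqI[OF assms(2) u] show ?thesis
    by (simp add: spn_output_def circuit_value_def node_value_map_nodes[OF assms])
qed

text \<open>A path into \<open>u\<close> is empty or ends with an edge from a child, so scopes can
  be computed level by level.\<close>

lemma dependency_scope_unfold:
  "dependency_scope \<Phi> u =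
     {i. \<exists>j. label \<Phi> u = Variable (i, j)} \<union> (\<Union>v\<in>children \<Phi> u. dependency_scope \<Phi> v)"
  unfolding dependency_scope_def children_def
  by (auto elim: rtranclE intro: rtrancl_into_rtrancl)


section \<open>The circuit of a state-space model\<close>

text \<open>
  Time is counted from zero: \<open>State t b\<close> is the state after \<open>t\<close> steps, while \<open>Step t a b\<close> and
  \<open>Transition t a b\<close> belong to the step from time \<open>t\<close> to time \<open>Suc t\<close>, which reads the variable
  with index \<open>\<pi> (Suc t)\<close>.
\<close>

datatype fpssm_node =
  Transition nat nat nat | Step nat nat nat | State nat nat | Output

instance fpssm_node :: countable
  by countable_datatype

fun fpssm_children :: "nat \<Rightarrow> nat \<Rightarrow> fpssm_node \<Rightarrow> fpssm_node set" where
  "fpssm_children n k (Transition t a b) = {}"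
| "fpssm_children n k (Step t a b) = {Transition t a b, State t a}"
| "fpssm_children n k (State 0 b) = {}"
| "fpssm_children n k (State (Suc t) b) = (\<lambda>a. Step t a b) ` {1..k}"
| "fpssm_children n k Output = State n ` {1..k}"

definition fpssm_nodes :: "nat \<Rightarrow> nat \<Rightarrow> fpssm_node set" where
  "fpssm_nodes n k =
     (\<lambda>(t, a, b). Transition t a b) ` ({..<n} \<times> {1..k} \<times> {1..k}) \<union>
     (\<lambda>(t, a, b). Step t a b) ` ({..<n} \<times> {1..k} \<times> {1..k}) \<union>
     (\<lambda>(t, b). State t b) ` ({..n} \<times> {1..k}) \<union> {Output}"

text \<open>
  The pairs of states \<open>(a, b)\<close> are numbered from \<open>1\<close> to \<open>k * k\<close>, and \<open>transition_indicator\<close>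
  decodes such a number.
\<close>

definition transition_index :: "nat \<Rightarrow> nat \<Rightarrow> nat \<Rightarrow> nat" where
  "transition_index k a b = (a - 1) * k + b"

definition transition_indicator ::
  "nat \<Rightarrow> (nat \<Rightarrow> real \<Rightarrow> nat \<Rightarrow> nat) \<Rightarrow> nat \<Rightarrow> nat \<Rightarrow> real \<Rightarrow> real" where
  "transition_indicator k g i j s =
     of_bool (g i s (Suc ((j - 1) div k)) = Suc ((j - 1) mod k))"

fun fpssm_label :: "nat \<Rightarrow> (nat \<Rightarrow> nat) \<Rightarrow> nat \<Rightarrow> fpssm_node \<Rightarrow> (nat \<times> nat) node_label" where
  "fpssm_label k \<pi> c (Transition t a b) = Variable (\<pi> (Suc t), transition_index k a b)"
| "fpssm_label k \<pi> c (Step t a b) = Product"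
| "fpssm_label k \<pi> c (State 0 b) = Constant (of_bool (b = c))"
| "fpssm_label k \<pi> c (State (Suc t) b) = Sum"
| "fpssm_label k \<pi> c Output = Sum"

text \<open>The only edges from a \<open>State\<close> node into a sum node are those into \<open>Output\<close>.\<close>

definition fpssm_circuit ::
  "nat \<Rightarrow> nat \<Rightarrow> (nat \<Rightarrow> nat) \<Rightarrow> nat \<Rightarrow> (nat \<Rightarrow> real) \<Rightarrow> (fpssm_node, nat \<times> nat) circuit" where
  "fpssm_circuit n k \<pi> c h =
     \<lparr>nodes = fpssm_nodes n k,
      edges = {(v, u). u \<in> fpssm_nodes n k \<and> v \<in> fpssm_children n k u},
      label = fpssm_label k \<pi> c,
      weight = (\<lambda>v u. case v of State t b \<Rightarrow> h b | _ \<Rightarrow> 1)\<rparr>"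

section \<open>Graph of the network: node count, acyclicity and unique root\<close>

lemma fpssm_circuit_simps [simp]:
  "nodes (fpssm_circuit n k \<pi> c h) = fpssm_nodes n k"
  "edges (fpssm_circuit n k \<pi> c h) = {(v, u). u \<in> fpssm_nodes n k \<and> v \<in> fpssm_children n k u}"
  "label (fpssm_circuit n k \<pi> c h) = fpssm_label k \<pi> c"
  "weight (fpssm_circuit n k \<pi> c h) v u = (case v of State t b \<Rightarrow> h b | _ \<Rightarrow> 1)"
  by (simp_all add: fpssm_circuit_def)

lemma children_fpssm_circuit [simp]:
  "u \<in> fpssm_nodes n k \<Longrightarrow> children (fpssm_circuit n k \<pi> c h) u = fpssm_children n k u"
  by (simp add: children_def)

lemma fpssm_nodes_iff [simp]:
  "Transition t a b \<in> fpssm_nodes n k \<longleftrightarrow> t < n \<and> a \<in> {1..k} \<and> b \<in> {1..k}"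
  "Step t a b \<in> fpssm_nodes n k \<longleftrightarrow> t < n \<and> a \<in> {1..k} \<and> b \<in> {1..k}"
  "State t b \<in> fpssm_nodes n k \<longleftrightarrow> t \<le> n \<and> b \<in> {1..k}"
  "Output \<in> fpssm_nodes n k"
  by (force simp: fpssm_nodes_def)+

lemma finite_fpssm_nodes: "finite (fpssm_nodes n k)"
  by (simp add: fpssm_nodes_def)

lemma card_fpssm_nodes_le: "card (fpssm_nodes n k) \<le> 2 * (n * k * k) + Suc n * k + 1"
proof -
  let ?A = "{..<n} \<times> {1..k} \<times> {1..k}" and ?B = "{..n} \<times> {1..k}"
  have "card (fpssm_nodes n k) \<le>
      card ((\<lambda>(t, a, b). Transition t a b) ` ?A) + card ((\<lambda>(t, a, b). Step t a b) ` ?A)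
      + card ((\<lambda>(t, b). State t b) ` ?B) + card {Output}"
    unfolding fpssm_nodes_def by (intro order.trans[OF card_Un_le] add_mono order.refl)
  also have "\<dots> \<le> card ?A + card ?A + card ?B + card {Output}"
    by (intro add_mono card_image_le order.refl) auto
  finally show ?thesis by (simp add: card_cartesian_product mult.assoc)
qed

lemma fpssm_children_subset:
  assumes "u \<in> fpssm_nodes n k"
  shows "fpssm_children n k u \<subseteq> fpssm_nodes n k"
proof (cases u)
  case (State t b)
  with assms show ?thesis by (cases t) auto
qed (use assms in auto)

text \<open>A height function witnessing acyclicity: states sit at odd ranks, the products between
  two consecutive times at the even rank in between, and \<open>Output\<close> just above the final
  states.\<close>

fun fpssm_rank :: "nat \<Rightarrow> fpssm_node \<Rightarrow> nat" where
  "fpssm_rank n (Transition t a b) = 0"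
| "fpssm_rank n (Step t a b) = 2 * t + 2"
| "fpssm_rank n (State t b) = 2 * t + 1"
| "fpssm_rank n Output = 2 * n + 2"

lemma fpssm_rank_less: "v \<in> fpssm_children n k u \<Longrightarrow> fpssm_rank n v < fpssm_rank n u"
  by (induction n k u rule: fpssm_children.induct) auto

lemma acyclic_fpssm_circuit: "acyclic (edges (fpssm_circuit n k \<pi> c h))"
  by (rule wf_acyclic, rule wf_subset[OF wf_measure[of "fpssm_rank n"]])
     (auto simp: fpssm_rank_less)

lemma is_root_fpssm_circuit:
  assumes "k \<ge> 1"
  shows "is_root (fpssm_circuit n k \<pi> c h) u \<longleftrightarrow> u = Output"
proof
  assume root: "is_root (fpssm_circuit n k \<pi> c h) u"
  show "u = Output"
  proof (cases u)
    case (Transition t a b)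
    with root show ?thesis by (auto simp: is_root_def dest: spec[of _ "Step t a b"])
  next
    case (Step t a b)
    with root show ?thesis by (auto simp: is_root_def dest: spec[of _ "State (Suc t) b"])
  next
    case (State t b)
    show ?thesis
    proof (cases "t = n")
      case True
      with root State show ?thesis by (auto simp: is_root_def dest: spec[of _ Output])
    next
      case False
      with root State assms show ?thesis
        \<comment> \<open>Any successor state would do; 1 is available because
          \<open>k \<ge> 1\<close>.\<close>
        by (auto simp: is_root_def dest: spec[of _ "Step t b 1"])
    qed
  qed
next
  have "Output \<notin> fpssm_children n k w" for w
    by (induction n k w rule: fpssm_children.induct) auto
  then show "u = Output \<Longrightarrow> is_root (fpssm_circuit n k \<pi> c h) u"
    by (simp add: is_root_def)
qed

section \<open>Numbering of transitions, well-formedness and monotonicity\<close>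

lemma transition_index_bounds:
  assumes "a \<in> {1..k}" "b \<in> {1..k}"
  shows "transition_index k a b \<in> {1..k * k}"
proof -
  have "(a - 1) * k + b \<le> (k - 1) * k + k"
    using assms by (intro add_mono mult_right_mono) auto
  also have "\<dots> = k * k"
    using assms by (cases k) auto
  finally show ?thesis using assms by (simp add: transition_index_def)
qed

text \<open>For \<open>a = Suc a'\<close> and \<open>b = Suc b'\<close> the index minus one is
  \<open>a' * k + b'\<close> with \<open>b' < k\<close>, so division with remainder by
  \<open>k\<close> recovers both states.\<close>

lemma transition_indicator_index:
  assumes "a \<in> {1..k}" "b \<in> {1..k}"
  shows "transition_indicator k g i (transition_index k a b) s = of_bool (g i s a = b)"
proof -
  obtain a' b' where "a = Suc a'" "b = Suc b'" "b' < k"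
    using assms by (cases a; cases b) auto
  then show ?thesis by (simp add: transition_indicator_def transition_index_def)
qed

text \<open>The assumption \<open>k \<ge> 1\<close> gives every sum node a child; a childless node
  could not carry the label \<open>Sum\<close>. That the leaves use admissible variables relies on
  \<open>\<pi>\<close> mapping \<open>{1..n}\<close> to itself.\<close>

lemma arithmetic_circuit_fpssm_circuit:
  assumes "\<pi> permutes {1..n}" "k \<ge> 1"
  shows "arithmetic_circuit (SIGMA i:{1..n}. {1..k * k}) (fpssm_circuit n k \<pi> c h)"
proof -
  have "if fpssm_children n k u = {}
        then fpssm_label k \<pi> c u \<in> Variable ` (SIGMA i:{1..n}. {1..k * k}) \<union> range Constant
        else fpssm_label k \<pi> c u \<in> {Product, Sum}" if u: "u \<in> fpssm_nodes n k" for u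
  proof (cases u)
    case (Transition t a b)
    with u have "\<pi> (Suc t) \<in> {1..n}"
      by (subst permutes_in_image[OF assms(1)]) auto
    with u Transition show ?thesis
      using transition_index_bounds[of a k b] by auto
  next
    case (State t b)
    with assms show ?thesis by (cases t) auto
  qed (use assms in auto)
  moreover have "edges (fpssm_circuit n k \<pi> c h) \<subseteq> fpssm_nodes n k \<times> fpssm_nodes n k"
    using fpssm_children_subset by fastforce
  moreover have "\<exists>!u. is_root (fpssm_circuit n k \<pi> c h) u"
    by (rule ex1I[of _ Output]) (simp_all only: is_root_fpssm_circuit[OF assms(2)])
  moreover note acyclic_fpssm_circuit[of n k \<pi> c h]
  ultimately show ?thesis
    by (simp add: arithmetic_circuit_def finite_fpssm_nodes cong: if_cong split del: if_split)
qed

lemma monotone_fpssm_circuit: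
  assumes "\<forall>a\<in>{1..k}. h a \<ge> 0"
  shows "monotone_circuit (fpssm_circuit n k \<pi> c h)"
proof -
  have "r \<ge> 0" if "fpssm_label k \<pi> c u = Constant r" for u r
    using that by (induction k \<pi> c u rule: fpssm_label.induct) auto
  moreover have "(case v of State t b \<Rightarrow> h b | _ \<Rightarrow> 1) \<ge> 0"
    if "u \<in> fpssm_nodes n k" "v \<in> fpssm_children n k u" for u v
    using fpssm_children_subset[OF that(1)] that(2) assms by (auto split: fpssm_node.split)
  ultimately show ?thesis by (simp add: monotone_circuit_def)
qed

section \<open>Dependency scopes, decomposability and completeness\<close>

lemma dependency_scope_Transition:
  "t < n \<Longrightarrow> a \<in> {1..k} \<Longrightarrow> b \<in> {1..k} \<Longrightarrow>
     dependency_scope (fpssm_circuit n k \<pi> c h) (Transition t a b) = {\<pi> (Suc t)}"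
  by (subst dependency_scope_unfold) auto

lemma dependency_scope_State:
  "t \<le> n \<Longrightarrow> b \<in> {1..k} \<Longrightarrow>
     dependency_scope (fpssm_circuit n k \<pi> c h) (State t b) = \<pi> ` {1..t}"
  and dependency_scope_Step:
  "t < n \<Longrightarrow> a \<in> {1..k} \<Longrightarrow> b \<in> {1..k} \<Longrightarrow>
     dependency_scope (fpssm_circuit n k \<pi> c h) (Step t a b) = \<pi> ` {1..Suc t}"
proof -
  let ?scope = "dependency_scope (fpssm_circuit n k \<pi> c h)"
  \<comment> \<open>The two scopes are mutually recursive. Keeping the scope of
    \<open>State t a\<close> as a premise lets this fact serve inside the induction on time.\<close>
  have Step: "?scope (Step t a b) = \<pi> ` {1..Suc t}"
    if "t < n" "a \<in> {1..k}" "b \<in> {1..k}" "?scope (State t a) = \<pi> ` {1..t}" for t a b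
    using that
    by (subst dependency_scope_unfold) (auto simp: dependency_scope_Transition atLeastAtMostSuc_conv)
  have State: "?scope (State t b) = \<pi> ` {1..t}" if "t \<le> n" "b \<in> {1..k}" for t b
    using that
  proof (induction t arbitrary: b)
    case 0
    then show ?case by (subst dependency_scope_unfold) auto
  next
    case (Suc t)
    then have "?scope (Step t a b) = \<pi> ` {1..Suc t}" if "a \<in> {1..k}" for a
      using that by (intro Step) auto
    \<comment> \<open>A union of equal scopes is that scope only if the union is over a nonempty
      set.\<close>
    moreover have "{1..k} \<noteq> {}"
      using Suc.prems by auto
    ultimately show ?case
      using Suc.prems by (subst dependency_scope_unfold) simp
  qed
  show "t \<le> n \<Longrightarrow> b \<in> {1..k} \<Longrightarrow> ?scope (State t b) = \<pi> ` {1..t}"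
    by (rule State)
  show "t < n \<Longrightarrow> a \<in> {1..k} \<Longrightarrow> b \<in> {1..k} \<Longrightarrow> ?scope (Step t a b) = \<pi> ` {1..Suc t}"
    by (rule Step) (auto simp: State)
qed

text \<open>The only products are \<open>Step\<close> nodes; their leaf reads the variable at
  \<open>\<pi> (Suc t)\<close>, and injectivity of \<open>\<pi>\<close> keeps it apart from the
  variables read earlier.\<close>

lemma decomposable_fpssm_circuit:
  assumes "\<pi> permutes {1..n}"
  shows "decomposable (fpssm_circuit n k \<pi> c h)"
proof -
  have "\<pi> (Suc t) \<notin> \<pi> ` {1..t}" for t
    using permutes_inj[OF assms] by (auto simp: inj_eq)
  then have "dependency_scope (fpssm_circuit n k \<pi> c h) v \<inter>
      dependency_scope (fpssm_circuit n k \<pi> c h) w = {}"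
    if "Step t a b \<in> fpssm_nodes n k" "v \<noteq> w"
      "v \<in> fpssm_children n k (Step t a b)" "w \<in> fpssm_children n k (Step t a b)" for t a b v w
    using that by (auto simp: dependency_scope_Transition dependency_scope_State)
  moreover have "\<exists>t a b. u = Step t a b" if "fpssm_label k \<pi> c u = Product" for u
    using that by (induction k \<pi> c u rule: fpssm_label.induct) auto
  ultimately show ?thesis
    unfolding decomposable_def
    by (metis (no_types, lifting) children_fpssm_circuit fpssm_circuit_simps(1,3))
qed

text \<open>Scopes are syntactic and every pair of states has its own leaf, even for transitions
  that never occur, so the scope of a \<open>State\<close> or \<open>Step\<close> node depends on
  its time only.\<close>

lemma complete_fpssm_circuit: "complete_circuit (fpssm_circuit n k \<pi> c h)"
proof -
  have "\<exists>S. \<forall>v\<in>fpssm_children n k u. dependency_scope (fpssm_circuit n k \<pi> c h) v = S"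
    if "u \<in> fpssm_nodes n k" "fpssm_label k \<pi> c u = Sum" for u
  proof (cases u)
    case (State t b)
    with that show ?thesis by (cases t) (auto simp: dependency_scope_Step)
  qed (use that in \<open>auto simp: dependency_scope_State\<close>)
  then show ?thesis
    unfolding complete_circuit_def
    by (metis children_fpssm_circuit fpssm_circuit_simps(1,3))
qed

section \<open>Integrability of the indicators and choice of measures\<close>

lemma integrable_transition_indicator:
  assumes M: "compatible_measures n R k g M" and ij: "i \<in> {1..n}" "j \<in> {1..k * k}"
  shows "integrable (M i) (transition_indicator k g i j)"
proof -
  interpret finite_measure "M i"
    using M ij by (simp add: compatible_measures_def)
  \<comment> \<open>As \<open>j\<close> is at most \<open>k * k\<close>, the decoded source state
    lies in \<open>{1..k}\<close>, where compatibility provides measurability.\<close>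
  have "(j - 1) div k < k"
    using ij by (intro less_mult_imp_div_less) auto
  then have "(\<lambda>s. g i s (Suc ((j - 1) div k))) \<in> M i \<rightarrow>\<^sub>M count_space {1..k}"
    using M ij by (simp add: compatible_measures_def)
  then have "transition_indicator k g i j \<in> borel_measurable (M i)"
    unfolding transition_indicator_def
    by (rule measurable_compose[where g = "\<lambda>b. of_bool (b = Suc ((j - 1) mod k))"]) simp
  then show ?thesis
    by (intro integrable_const_bound[where B = 1]) (auto simp: transition_indicator_def)
qed

lemma dc_spn_fpssm_circuit:
  assumes "fpssm n R k \<pi> c h g" "compatible_measures n R k g M"
  shows "dc_spn n R M (\<lambda>_. k * k) (transition_indicator k g) (fpssm_circuit n k \<pi> c h)"
proof -
  have "\<pi> permutes {1..n}" "k \<ge> 1" "\<forall>a\<in>{1..k}. h a \<ge> 0"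
    using assms(1) by (auto simp: fpssm_def)
  then show ?thesis
    using assms(2) integrable_transition_indicator[OF assms(2)]
      arithmetic_circuit_fpssm_circuit[of \<pi> n k c h]
    by (simp add: dc_spn_def spn_def monotone_fpssm_circuit decomposable_fpssm_circuit
        complete_fpssm_circuit compatible_measures_def transition_indicator_def)
qed

text \<open>On the discrete sigma-algebra every map from \<open>R i\<close> to \<open>{1..k}\<close>
  is measurable, and the zero measure is finite. This supplies the measures whose existence the
  final statement claims.\<close>

lemma compatible_null_measure:
  assumes "fpssm n R k \<pi> c h g"
  shows "compatible_measures n R k g (\<lambda>i. null_measure (count_space (R i)))"
  using assms
  by (auto simp: compatible_measures_def fpssm_def measurable_def intro!: finite_measureI)

section \<open>Values of the nodes\<close>

lemma fpssm_state_in_range: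
  assumes "fpssm n R k \<pi> c h g" "\<forall>i\<in>{1..n}. x i \<in> R i" "t \<le> n"
  shows "fpssm_state \<pi> c g x t \<in> {1..k}"
  using assms(3)
proof (induction t)
  case 0
  then show ?case using assms(1) by (simp add: fpssm_def)
next
  case (Suc t)
  have "\<pi> (Suc t) \<in> {1..n}"
    using assms(1) Suc.prems permutes_in_image[of \<pi> "{1..n}" "Suc t"] by (simp add: fpssm_def)
  then show ?case
    using assms(1,2) Suc by (simp add: fpssm_def)
qed

text \<open>Induction on time. The model is deterministic, so among the products feeding
  \<open>State (Suc t) b\<close> only the one whose source is the actual state at time
  \<open>t\<close> can be nonzero.\<close>

lemma node_value_State:
  assumes "fpssm n R k \<pi> c h g" "\<forall>i\<in>{1..n}. x i \<in> R i" "t \<le> n" "b \<in> {1..k}"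
  shows "node_value (fpssm_circuit n k \<pi> c h) (\<lambda>(i, j). transition_indicator k g i j (x i))
           (State t b) = of_bool (fpssm_state \<pi> c g x t = b)"
  using assms(3,4)
proof (induction t arbitrary: b)
  note unfold = node_value_unfold[OF arithmetic_circuit_fpssm_circuit]
  have hyps: "\<pi> permutes {1..n}" "k \<ge> 1"
    using assms(1) by (auto simp: fpssm_def)
  let ?q = "node_value (fpssm_circuit n k \<pi> c h) (\<lambda>(i, j). transition_indicator k g i j (x i))"
  let ?s = "fpssm_state \<pi> c g x"
  {
    case 0
    then show ?case by (subst unfold[OF hyps]) auto
  next
    case (Suc t)
    \<comment> \<open>Replacing the successor of \<open>a\<close> by the actual next state is
      harmless, because the first factor vanishes unless \<open>a\<close> is the current
      state.\<close>
    have Step: "?q (Step t a b) = of_bool (?s t = a) * of_bool (?s (Suc t) = b)"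
      if a: "a \<in> {1..k}" for a
    proof -
      have "?q (Transition t a b) = of_bool (g (\<pi> (Suc t)) (x (\<pi> (Suc t))) a = b)"
        using Suc.prems a by (subst unfold[OF hyps]) (simp add: transition_indicator_index)
      then show ?thesis
        using Suc a by (subst unfold[OF hyps]) auto
    qed
    \<comment> \<open>Edges leaving \<open>Step\<close> nodes have weight 1.\<close>
    have "?q (State (Suc t) b) = (\<Sum>a\<in>{1..k}. ?q (Step t a b))"
      using Suc.prems by (subst unfold[OF hyps]) (simp add: sum.reindex inj_on_def)
    also have "\<dots> = (\<Sum>a\<in>{1..k}. of_bool (?s t = a) * of_bool (?s (Suc t) = b))"
      using Step by (intro sum.cong) auto
    also have "\<dots> = of_bool (?s (Suc t) = b)"
      using fpssm_state_in_range[OF assms(1,2), of t] Suc.prems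
      by (simp flip: sum_distrib_right add: of_bool_def)
    finally show ?case .
  }
qed

lemma spn_output_fpssm_circuit:
  assumes "fpssm n R k \<pi> c h g" "\<forall>i\<in>{1..n}. x i \<in> R i"
  shows "spn_output (transition_indicator k g) (fpssm_circuit n k \<pi> c h) x
           = fpssm_output n \<pi> c h g x"
proof -
  have hyps: "\<pi> permutes {1..n}" "k \<ge> 1"
    using assms(1) by (auto simp: fpssm_def)
  note circuit = arithmetic_circuit_fpssm_circuit[OF hyps, of c h]
  let ?q = "node_value (fpssm_circuit n k \<pi> c h) (\<lambda>(i, j). transition_indicator k g i j (x i))"
  let ?s = "fpssm_state \<pi> c g x"
  \<comment> \<open>The weight \<open>h b\<close> sits on the edge from \<open>State n b\<close>, so
    the decoding happens at the root.\<close>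
  have "?q Output = (\<Sum>b\<in>{1..k}. h b * ?q (State n b))"
    by (subst node_value_unfold[OF circuit]) (simp add: sum.reindex inj_on_def)
  also have "\<dots> = (\<Sum>b\<in>{1..k}. if ?s n = b then h b else 0)"
    by (intro sum.cong) (auto simp: node_value_State[OF assms])
  also have "\<dots> = h (?s n)"
    using fpssm_state_in_range[OF assms, of n] by simp
  finally show ?thesis
    using root_eqI[OF circuit, of Output] is_root_fpssm_circuit[OF hyps(2)]
    by (simp add: spn_output_def circuit_value_def fpssm_output_def)
qed

section \<open>Size bound and conclusion\<close>

lemma circuit_size_fpssm_circuit:
  assumes "n \<ge> 1" "k \<ge> 1"
  shows "real (circuit_size (fpssm_circuit n k \<pi> c h)) \<le> 5 * real n * real k ^ 2"
proof -
  \<comment> \<open>The node count is at most 2nk^2 + nk + k + 1; since n and k are positive, each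
    of the last three terms is at most nk^2, whence the factor 5.\<close>
  have k: "k \<le> k * k" and nk: "1 \<le> n * (k * k)"
    using assms by auto
  have "n * k \<le> n * (k * k)" "k * k \<le> n * (k * k)"
    using assms by auto
  with k nk have "card (fpssm_nodes n k) \<le> 5 * (n * (k * k))"
    using card_fpssm_nodes_le[of n k] unfolding mult_Suc mult.assoc by linarith
  then have "real (card (fpssm_nodes n k)) \<le> real (5 * (n * (k * k)))"
    by (rule of_nat_mono)
  then show ?thesis by (simp add: circuit_size_def power2_eq_square)
qed

theorem corollary23:
  "\<exists>C::real. \<forall>(n::nat) (R :: nat \<Rightarrow> real set) (k::nat) \<pi> c h g.
     fpssm n R k \<pi> c h g \<longrightarrow>
     (\<exists>(m :: nat \<Rightarrow> nat) (f :: nat \<Rightarrow> nat \<Rightarrow> real \<Rightarrow> real) (\<Phi> :: (nat, nat \<times> nat) circuit).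
        (\<exists>M. dc_spn n R M m f \<Phi>) \<and>
        (\<forall>M. compatible_measures n R k g M \<longrightarrow> dc_spn n R M m f \<Phi>) \<and>
        real (circuit_size \<Phi>) \<le> C * real n * real k ^ 2 \<and>
        (\<forall>x. (\<forall>i\<in>{1..n}. x i \<in> R i) \<longrightarrow> spn_output f \<Phi> x = fpssm_output n \<pi> c h g x))"
proof (intro exI[of _ 5] allI impI)
  fix n R k \<pi> c h g
  assume model: "fpssm n R k \<pi> c h g"
  then have hyps: "\<pi> permutes {1..n}" "n \<ge> 1" "k \<ge> 1"
    by (auto simp: fpssm_def)
  let ?e = "to_nat :: fpssm_node \<Rightarrow> nat"
  let ?\<Phi> = "map_nodes ?e (fpssm_circuit n k \<pi> c h)"
  let ?f = "transition_indicator k g"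
  have inj: "inj ?e" by simp
  \<comment> \<open>Neither the circuit nor the tuple of indicators depends on \<open>M\<close>, so
    one network serves all compatible measures. There are \<open>k * k\<close> functions per
    variable, one for each pair of states.\<close>
  have dc: "dc_spn n R M (\<lambda>_. k * k) ?f ?\<Phi>" if "compatible_measures n R k g M" for M
    using dc_spn_map_nodes[OF inj dc_spn_fpssm_circuit[OF model that]] .
  show "\<exists>m f (\<Phi> :: (nat, nat \<times> nat) circuit).
        (\<exists>M. dc_spn n R M m f \<Phi>) \<and>
        (\<forall>M. compatible_measures n R k g M \<longrightarrow> dc_spn n R M m f \<Phi>) \<and>
        real (circuit_size \<Phi>) \<le> 5 * real n * real k ^ 2 \<and>
        (\<forall>x. (\<forall>i\<in>{1..n}. x i \<in> R i) \<longrightarrow> spn_output f \<Phi> x = fpssm_output n \<pi> c h g x)"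
  proof (intro exI conjI allI impI)
    show "dc_spn n R (\<lambda>i. null_measure (count_space (R i))) (\<lambda>_. k * k) ?f ?\<Phi>"
      by (rule dc[OF compatible_null_measure[OF model]])
    show "dc_spn n R M (\<lambda>_. k * k) ?f ?\<Phi>" if "compatible_measures n R k g M" for M
      by (rule dc[OF that])
    show "real (circuit_size ?\<Phi>) \<le> 5 * real n * real k ^ 2"
      using circuit_size_fpssm_circuit[OF hyps(2,3)] by (simp add: circuit_size_map_nodes[OF inj])
    show "spn_output ?f ?\<Phi> x = fpssm_output n \<pi> c h g x" if "\<forall>i\<in>{1..n}. x i \<in> R i" for x
      using spn_output_fpssm_circuit[OF model that]
      by (simp add: spn_output_map_nodes[OF inj arithmetic_circuit_fpssm_circuit[OF hyps(1,3)]])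
  qed
qed

end
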